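(* Let $\mathsf T$ be a finite nonempty set of homogeneous terms and $\mathsf D$ a finite set of formulas of the form $d\mid t$ with $d\geq 1$ and $t$ a homogeneous term, all terms using variables among $y_1,\dots,y_r$. Let $\ell>\max(\{\|t\|_+ : t\in\mathsf T\}\cup\{\|t\|_-:t\in\mathsf T\})$ and $\ell'>\max\{d : d\mid t\in\mathsf D\}$ be integers. Let $\psi$ be a Boolean combination of atomic formulas $t\bowtie c$ and $d\mid t+c'$ where $t\in\mathsf T$ (in the first kind), $d\mid t\in\mathsf D$ (in the second kind), $c,c'\in\mathbb Z$ with $-\ell<c<\ell$, and $\bowtie\in\{=,\neq,<,\leq,>,\geq\}$. Then the minimal deterministic word automaton representing $\{\bar a\in\mathbb{Z}^r:(\mathbb{Z},<,+)\models\psi[\bar a]\}$ has at most $(2+2\ell)^{|\mathsf T|}\cdot \ell'^{|\mathsf D|}$ states.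
   Context: A term is homogeneous if it is $0$ or of the form $k_1\cdot x_1+\dots+k_m\cdot x_m$ with pairwise distinct variables and nonzero integer coefficients $k_i$. For such $t$, $\|t\|_-=\sum_{k_j<0}|k_j|$ and $\|t\|_+=\sum_{k_j>0}k_j$. Encoding: fix an integer base $\varrho\geq 2$ and $\Sigma=\{0,\dots,\varrho-1\}$. For $b_{n-1}\dots b_0\in\Sigma^*$ let $\langle b_{n-1}\dots b_0\rangle_{\mathbb N}=\sum_{i<n}\varrho^i b_i$; for $b_nb_{n-1}\dots b_0\in\Sigma^+$ let $\langle b_n\dots b_0\rangle_{\mathbb Z}=\langle b_{n-1}\dots b_0\rangle_{\mathbb N}$ if $b_n=0$ and $\langle b_{n-1}\dots b_0\rangle_{\mathbb N}-\varrho^n$ if $b_n\neq 0$. Words over $\Sigma^r$ are read componentwise (track $i$ encodes the value of $y_i$), giving $\langle w\rangle_{\mathbb Z}\in\mathbb{Z}^r$ for $w\in(\Sigma^r)^+$. A deterministic word automaton $\mathcal A$ over $\Sigma^r$ represents $U\subseteq\mathbb{Z}^r$ if $L(\mathcal A)=\{w\in(\Sigma^r)^+:\langle w\rangle_{\mathbb Z}\in U\}$. *)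

theory Defs
  imports Main
begin

section \<open>Homogeneous terms\<close>

text \<open>
  A term is the list of its summands: \<open>[(k\<^sub>1, i\<^sub>1), \<dots>, (k\<^sub>m, i\<^sub>m)]\<close> stands for
  \<open>k\<^sub>1 \<cdot> x\<^sub>1 + \<dots> + k\<^sub>m \<cdot> x\<^sub>m\<close>, where \<open>x\<^sub>j\<close> is the variable with index \<open>i\<^sub>j\<close>, and
  \<open>[]\<close> is the term \<open>0\<close>. Variables are indexed from \<open>0\<close>, so \<open>y\<^sub>1, \<dots>, y\<^sub>r\<close> have the
  indices \<open>0, \<dots>, r - 1\<close>.
\<close>

type_synonym lterm = "(int \<times> nat) list"

definition homogeneous :: "lterm \<Rightarrow> bool" where
  "homogeneous t \<longleftrightarrow> distinct (map snd t) \<and> (\<forall>(k, i) \<in> set t. k \<noteq> 0)"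

definition term_vars :: "lterm \<Rightarrow> nat set" where
  "term_vars t = snd ` set t"

definition neg_norm :: "lterm \<Rightarrow> int" where
  "neg_norm t = (\<Sum>(k, i) \<leftarrow> t. if k < 0 then \<bar>k\<bar> else 0)"

definition pos_norm :: "lterm \<Rightarrow> int" where
  "pos_norm t = (\<Sum>(k, i) \<leftarrow> t. if k > 0 then k else 0)"

definition term_val :: "int list \<Rightarrow> lterm \<Rightarrow> int" where
  "term_val a t = (\<Sum>(k, i) \<leftarrow> t. k * a ! i)"


section \<open>Quantifier-free formulas\<close>

datatype comparison = Eq | Neq | Less | LessEq | Greater | GreaterEq

text \<open>\<open>Cmp t R c\<close> is \<open>t R c\<close>, and \<open>Divides d t c\<close> is \<open>d | t + c\<close>.\<close>

datatype atomic = Cmp lterm comparison int | Divides int lterm int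

datatype (atoms: 'a) bool_comb =
    Atom 'a
  | Neg "'a bool_comb"
  | Conj "'a bool_comb" "'a bool_comb"
  | Disj "'a bool_comb" "'a bool_comb"

primrec comparison_holds :: "comparison \<Rightarrow> int \<Rightarrow> int \<Rightarrow> bool" where
  "comparison_holds Eq x y \<longleftrightarrow> x = y"
| "comparison_holds Neq x y \<longleftrightarrow> x \<noteq> y"
| "comparison_holds Less x y \<longleftrightarrow> x < y"
| "comparison_holds LessEq x y \<longleftrightarrow> x \<le> y"
| "comparison_holds Greater x y \<longleftrightarrow> x > y"
| "comparison_holds GreaterEq x y \<longleftrightarrow> x \<ge> y"

primrec atomic_holds :: "int list \<Rightarrow> atomic \<Rightarrow> bool" where
  "atomic_holds a (Cmp t R c) \<longleftrightarrow> comparison_holds R (term_val a t) c"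
| "atomic_holds a (Divides d t c) \<longleftrightarrow> d dvd term_val a t + c"

primrec formula_holds :: "int list \<Rightarrow> atomic bool_comb \<Rightarrow> bool" where
  "formula_holds a (Atom p) \<longleftrightarrow> atomic_holds a p"
| "formula_holds a (Neg \<phi>) \<longleftrightarrow> \<not> formula_holds a \<phi>"
| "formula_holds a (Conj \<phi> \<chi>) \<longleftrightarrow> formula_holds a \<phi> \<and> formula_holds a \<chi>"
| "formula_holds a (Disj \<phi> \<chi>) \<longleftrightarrow> formula_holds a \<phi> \<or> formula_holds a \<chi>"


section \<open>Encoding of integers by words\<close>

text \<open>
  Words are lists, most significant digit first, so the digit \<open>b\<^sub>i\<close> of
  \<open>[b\<^sub>n\<^sub>-\<^sub>1, \<dots>, b\<^sub>0]\<close> is at position \<open>i\<close> of the reversed list.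
\<close>

definition nat_code :: "int \<Rightarrow> int list \<Rightarrow> int" where
  "nat_code \<rho> w = (\<Sum>i < length w. \<rho> ^ i * rev w ! i)"

text \<open>Only meaningful on nonempty words; the leading letter determines the sign.\<close>

definition int_code :: "int \<Rightarrow> int list \<Rightarrow> int" where
  "int_code \<rho> w =
    (if hd w = 0 then nat_code \<rho> (tl w) else nat_code \<rho> (tl w) - \<rho> ^ length (tl w))"

definition tuple_alphabet :: "int \<Rightarrow> nat \<Rightarrow> int list set" where
  "tuple_alphabet \<rho> r = {b. length b = r \<and> set b \<subseteq> {0..<\<rho>}}"

definition tuple_code :: "int \<Rightarrow> nat \<Rightarrow> int list list \<Rightarrow> int list" where
  "tuple_code \<rho> r w = map (\<lambda>i. int_code \<rho> (map (\<lambda>b. b ! i) w)) [0..<r]"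


section \<open>Deterministic word automata\<close>

record ('q, 'a) dwa =
  states :: "'q set"
  alphabet :: "'a set"
  trans_fun :: "'q \<Rightarrow> 'a \<Rightarrow> 'q"
  init_state :: 'q
  accepting :: "'q set"

definition is_dwa :: "('q, 'a) dwa \<Rightarrow> bool" where
  "is_dwa A \<longleftrightarrow>
    finite (states A) \<and> finite (alphabet A) \<and>
    (\<forall>q \<in> states A. \<forall>b \<in> alphabet A. trans_fun A q b \<in> states A) \<and>
    init_state A \<in> states A \<and> accepting A \<subseteq> states A"

definition language :: "('q, 'a) dwa \<Rightarrow> 'a list set" where
  "language A = {w \<in> lists (alphabet A). foldl (trans_fun A) (init_state A) w \<in> accepting A}"

text \<open>
  The competing automata have natural numbers as states. This is no restriction, since
  every finite state set can be renamed injectively into \<^typ>\<open>nat\<close>.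
\<close>

definition minimal_dwa :: "('q, 'a) dwa \<Rightarrow> bool" where
  "minimal_dwa A \<longleftrightarrow> is_dwa A \<and>
    (\<forall>B :: (nat, 'a) dwa. is_dwa B \<and> alphabet B = alphabet A \<and> language B = language A
      \<longrightarrow> card (states A) \<le> card (states B))"

definition represents :: "int \<Rightarrow> nat \<Rightarrow> ('q, int list) dwa \<Rightarrow> int list set \<Rightarrow> bool" where
  "represents \<rho> r A U \<longleftrightarrow>
    alphabet A = tuple_alphabet \<rho> r \<and>
    language A = {w \<in> lists (tuple_alphabet \<rho> r). w \<noteq> [] \<and> tuple_code \<rho> r w \<in> U}"

end

(*
  Apart from the initial state, which only remembers the empty word, it suffices to remember the
  residue modulo d of t for each (d, t) in D, and the value of each t in T truncated to [-l, l].
  Appending a letter b maps the value v of t to \<rho> v + t(b), where t(b) lies between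
  -(\<rho> - 1) (l - 1) and (\<rho> - 1) (l - 1); hence a value that has left the open interval (-l, l)
  never returns to it and truncation is compatible with the transitions. This gives at most
  1 + (2l + 1)^|T| (l' - 1)^|D| states.
*)
theory Submission
  imports Defs "HOL-Library.FuncSet"
begin

section \<open>Automata from right-invariant maps\<close>

text \<open>The easy half of Myhill-Nerode: the values of \<open>f\<close> serve as states. A
  transition picks any word with the current value and appends the letter; \<open>inv\<close> makes
  the choice irrelevant, and \<open>sat\<close> makes acceptance a property of the value.\<close>

lemma right_invariant_dwa:
  fixes f :: "'a list \<Rightarrow> 'k"
  assumes "finite \<Sigma>" and fin: "finite (f ` lists \<Sigma>)"
    and inv: "\<And>w w' b. w \<in> lists \<Sigma> \<Longrightarrow> w' \<in> lists \<Sigma> \<Longrightarrow> b \<in> \<Sigma> \<Longrightarrow> f w = f w' \<Longrightarrow>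
      f (w @ [b]) = f (w' @ [b])"
    and "L \<subseteq> lists \<Sigma>"
    and sat: "\<And>w w'. w \<in> L \<Longrightarrow> w' \<in> lists \<Sigma> \<Longrightarrow> f w = f w' \<Longrightarrow> w' \<in> L"
  obtains B :: "(nat, 'a) dwa"
  where "is_dwa B" "alphabet B = \<Sigma>" "language B = L" "card (states B) = card (f ` lists \<Sigma>)"
proof -
  \<comment> \<open>Values are numbered because \<open>minimal_dwa\<close> compares only with
    automata over \<open>nat\<close>.\<close>
  obtain g :: "'k \<Rightarrow> nat" where g: "inj_on g (f ` lists \<Sigma>)"
    using finite_imp_inj_to_nat_seg[OF fin] by blast
  define h where "h = g \<circ> f"
  have h: "h w = h w' \<longleftrightarrow> f w = f w'" if "w \<in> lists \<Sigma>" "w' \<in> lists \<Sigma>" for w w'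
    using g that unfolding h_def inj_on_def by auto
  define rep where "rep n = (SOME w. w \<in> lists \<Sigma> \<and> h w = n)" for n
  have rep: "rep (h w) \<in> lists \<Sigma> \<and> h (rep (h w)) = h w" if "w \<in> lists \<Sigma>" for w
    unfolding rep_def by (rule someI[of _ w]) (simp add: that)
  define B where "B = \<lparr>states = h ` lists \<Sigma>, alphabet = \<Sigma>,
    trans_fun = (\<lambda>n b. h (rep n @ [b])), init_state = h [], accepting = h ` L\<rparr>"
  have step: "h (rep (h w) @ [b]) = h (w @ [b])" if "w \<in> lists \<Sigma>" "b \<in> \<Sigma>" for w b
    using rep[OF that(1)] inv[of "rep (h w)" w b] that h unfolding h_def by auto
  have run: "foldl (trans_fun B) (init_state B) w = h w" if "w \<in> lists \<Sigma>" for w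
    using that
  proof (induction w rule: rev_induct)
    case Nil
    show ?case by (simp add: B_def)
  next
    case (snoc b w)
    then show ?case using step[of w b] by (simp add: B_def)
  qed
  have "is_dwa B"
    unfolding is_dwa_def
  proof (intro conjI ballI)
    show "finite (states B)" using finite_imageI[OF fin, of g] by (simp add: B_def h_def image_comp)
    show "trans_fun B q b \<in> states B" if "q \<in> states B" "b \<in> alphabet B" for q b
    proof -
      obtain w where "w \<in> lists \<Sigma>" "q = h w" using \<open>q \<in> states B\<close> by (auto simp: B_def)
      then show ?thesis using step[of w b] \<open>b \<in> alphabet B\<close> by (auto simp: B_def)
    qed
  qed (use assms(1,4) in \<open>auto simp: B_def\<close>)
  moreover have "language B = L"
  proof -
    have "h w \<in> h ` L \<longleftrightarrow> w \<in> L" if "w \<in> lists \<Sigma>" for w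
      using that h sat assms(4) by (smt (verit) imageE imageI subsetD)
    then show ?thesis
      using run assms(4) unfolding language_def
      by (simp add: B_def del: in_lists_conv_set cong: conj_cong) blast
  qed
  moreover have "card (states B) = card (f ` lists \<Sigma>)"
    using card_image[OF g] by (simp add: B_def h_def image_comp)
  ultimately show thesis using that[of B] by (simp add: B_def)
qed

lemma minimal_dwa_exists:
  fixes B :: "(nat, 'a) dwa"
  assumes "is_dwa B"
  shows "\<exists>A :: (nat, 'a) dwa. minimal_dwa A \<and> alphabet A = alphabet B \<and> language A = language B"
proof -
  let ?P = "\<lambda>A :: (nat, 'a) dwa. is_dwa A \<and> alphabet A = alphabet B \<and> language A = language B"
  obtain A where "?P A" "\<forall>C. ?P C \<longrightarrow> card (states A) \<le> card (states C)"
    using ex_has_least_nat[of ?P B "\<lambda>A. card (states A)"] assms by blast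
  then show ?thesis unfolding minimal_dwa_def by metis
qed

section \<open>Appending a letter\<close>

lemma nat_code_snoc: "nat_code \<rho> (w @ [b]) = \<rho> * nat_code \<rho> w + b"
  unfolding nat_code_def
  by (simp add: sum.lessThan_Suc_shift sum_distrib_left ac_simps del: sum.lessThan_Suc)

text \<open>The Horner step survives the sign correction, since the subtracted power also gains a
  factor \<open>\<rho>\<close> when the tail grows. On the empty word the appended digit would
  itself be the sign digit.\<close>

lemma int_code_snoc:
  assumes "w \<noteq> []"
  shows "int_code \<rho> (w @ [b]) = \<rho> * int_code \<rho> w + b"
  using assms by (cases w) (auto simp: int_code_def nat_code_snoc algebra_simps)

lemma tuple_code_snoc:
  assumes "w \<noteq> []" "i < r"
  shows "tuple_code \<rho> r (w @ [b]) ! i = \<rho> * tuple_code \<rho> r w ! i + b ! i"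
  using assms by (simp add: tuple_code_def int_code_snoc)

lemma length_tuple_code [simp]: "length (tuple_code \<rho> r w) = r"
  by (simp add: tuple_code_def)

text \<open>Terms have no constant summand, so evaluation is linear and the Horner step passes from
  the variables to the term.\<close>

lemma term_val_affine:
  assumes "\<And>i. i \<in> term_vars t \<Longrightarrow> a ! i = \<rho> * a' ! i + b ! i"
  shows "term_val a t = \<rho> * term_val a' t + term_val b t"
  using assms by (induction t) (auto simp: term_val_def term_vars_def algebra_simps)

lemma term_val_snoc:
  assumes "w \<noteq> []" "term_vars t \<subseteq> {..<r}"
  shows "term_val (tuple_code \<rho> r (w @ [b])) t =
    \<rho> * term_val (tuple_code \<rho> r w) t + term_val b t"
  using assms by (intro term_val_affine tuple_code_snoc) auto

lemma finite_tuple_alphabet: "finite (tuple_alphabet \<rho> r)"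
  using finite_lists_length_eq[of "{0..<\<rho>}" r] by (simp add: tuple_alphabet_def conj_commute)

lemma tuple_alphabet_nth:
  assumes "b \<in> tuple_alphabet \<rho> r" "i < r"
  shows "0 \<le> b ! i" "b ! i \<le> \<rho> - 1"
  proof -
  have "b ! i \<in> {0..<\<rho>}" using assms by (force simp: tuple_alphabet_def)
  then show "0 \<le> b ! i" "b ! i \<le> \<rho> - 1" by auto
qed

section \<open>Truncation\<close>

text \<open>A summand with coefficient \<open>k > 0\<close> lies in \<open>[0, m * k]\<close>, any
  other in \<open>[m * k, 0]\<close>, so each norm collects the extremes of one sign.\<close>

lemma term_val_bounds:
  assumes "\<And>i. i \<in> term_vars t \<Longrightarrow> 0 \<le> b ! i \<and> b ! i \<le> m"
  shows "- (m * neg_norm t) \<le> term_val b t" "term_val b t \<le> m * pos_norm t"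
proof -
  have "- (m * neg_norm t) \<le> term_val b t \<and> term_val b t \<le> m * pos_norm t"
    using assms
  proof (induction t)
    case Nil
    show ?case by (simp add: term_val_def neg_norm_def pos_norm_def)
  next
    case (Cons p t)
    obtain k i where p: "p = (k, i)" by (cases p)
    have bi: "0 \<le> b ! i" "b ! i \<le> m"
      using Cons.prems[of i] by (auto simp: term_vars_def p)
    have IH: "- (m * neg_norm t) \<le> term_val b t" "term_val b t \<le> m * pos_norm t"
      using Cons by (auto simp: term_vars_def)
    have val: "term_val b (p # t) = k * b ! i + term_val b t"
      by (simp add: p term_val_def)
    show ?case
    proof (cases "k > 0")
      case True
      have "0 \<le> k * b ! i" "k * b ! i \<le> m * k"
        using True bi by (auto simp: mult.commute[of m])
      moreover have "m * neg_norm (p # t) = m * neg_norm t"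
        "m * pos_norm (p # t) = m * k + m * pos_norm t"
        using True by (auto simp: p neg_norm_def pos_norm_def distrib_left)
      ultimately show ?thesis using val IH by linarith
    next
      case False
      have "k * b ! i \<le> 0" "m * k \<le> k * b ! i"
        using False bi by (auto simp: mult.commute[of m] intro: mult_nonpos_nonneg mult_left_mono_neg)
      moreover have "m * neg_norm (p # t) = m * - k + m * neg_norm t"
        "m * pos_norm (p # t) = m * pos_norm t"
        using False by (auto simp: p neg_norm_def pos_norm_def distrib_left)
      ultimately show ?thesis using val IH unfolding mult_minus_right by linarith
    qed
  qed
  then show "- (m * neg_norm t) \<le> term_val b t" "term_val b t \<le> m * pos_norm t" by auto
qed

definition clamp :: "int \<Rightarrow> int \<Rightarrow> int" where
  "clamp l v = max (- l) (min l v)"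

lemma clamp_eq_iff:
  assumes "l > 0"
  shows "clamp l x = clamp l y \<longleftrightarrow> x = y \<or> x \<ge> l \<and> y \<ge> l \<or> x \<le> - l \<and> y \<le> - l"
  using assms by (auto simp: clamp_def max_def min_def)

text \<open>Equal truncations mean equal values or a common ray \<open>z \<ge> l\<close> or
  \<open>z \<le> - l\<close>. Because \<open>\<rho> * l - (\<rho> - 1) * l = l\<close>, the step
  maps each ray into itself.\<close>

lemma clamp_step:
  assumes "l > 0" "\<rho> \<ge> 1" "- ((\<rho> - 1) * l) \<le> s" "s \<le> (\<rho> - 1) * l" "clamp l x = clamp l y"
  shows "clamp l (\<rho> * x + s) = clamp l (\<rho> * y + s)"
proof -
  have up: "\<rho> * z + s \<ge> l" if "z \<ge> l" for z
  proof -
    have "\<rho> * l \<le> \<rho> * z" using that assms(2) by (intro mult_left_mono) auto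
    then show ?thesis using assms(3) unfolding left_diff_distrib by linarith
  qed
  have down: "\<rho> * z + s \<le> - l" if "z \<le> - l" for z
  proof -
    have "\<rho> * z \<le> \<rho> * - l" using that assms(2) by (intro mult_left_mono) auto
    then show ?thesis using assms(4) unfolding left_diff_distrib by linarith
  qed
  show ?thesis
    using assms(5) up down unfolding clamp_eq_iff[OF assms(1)] by blast
qed

text \<open>\<open>c\<close> lies strictly between the two rays that \<open>clamp\<close> collapses,
  so all points of one ray compare with \<open>c\<close> alike.\<close>

lemma clamp_comparison:
  assumes "- l < c" "c < l" "clamp l x = clamp l y"
  shows "comparison_holds R x c \<longleftrightarrow> comparison_holds R y c"
proof -
  \<comment> \<open>The bounds on \<open>c\<close> imply \<open>l > 0\<close>, as
    \<open>clamp_eq_iff\<close> requires.\<close>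
  have "x = y \<or> x \<ge> l \<and> y \<ge> l \<or> x \<le> - l \<and> y \<le> - l"
    using assms clamp_eq_iff[of l x y] by auto
  then show ?thesis using assms(1,2) by (cases R) auto
qed

lemma mod_dvd_cong:
  fixes x y :: int
  assumes "x mod d = y mod d"
  shows "d dvd x + c \<longleftrightarrow> d dvd y + c"
  using mod_add_cong[OF assms refl[of "c mod d"]] by (simp add: dvd_eq_mod_eq_0)

lemma formula_holds_cong:
  assumes "\<And>p. p \<in> atoms \<phi> \<Longrightarrow> atomic_holds a p \<longleftrightarrow> atomic_holds b p"
  shows "formula_holds a \<phi> \<longleftrightarrow> formula_holds b \<phi>"
  using assms by (induction \<phi>) auto

text \<open>Pays for the extra initial state in the final count. Over the integers, strict
  monotonicity yields the gap of 1; the positive exponent it needs is supplied later by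
  \<open>T \<noteq> {}\<close>.\<close>

lemma power_Suc_base_ge:
  fixes x :: int
  assumes "x \<ge> 0" "n > 0"
  shows "x ^ n + 1 \<le> (x + 1) ^ n"
  using power_strict_mono[of x "x + 1" n] assms by linarith

section \<open>The invariant of a word\<close>

text \<open>\<open>None\<close> sets apart the empty word, which encodes no tuple and is never
  accepted. Restriction to \<open>T\<close> and \<open>D\<close> makes equality of keys mean
  agreement on these sets and lets the keys be counted in \<open>PiE\<close> spaces.\<close>

definition word_key ::
  "int \<Rightarrow> nat \<Rightarrow> int \<Rightarrow> lterm set \<Rightarrow> (int \<times> lterm) set \<Rightarrow> int list list \<Rightarrow>
    ((lterm \<Rightarrow> int) \<times> (int \<times> lterm \<Rightarrow> int)) option" where
  "word_key \<rho> r l T D w =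
    (if w = [] then None
     else Some (\<lambda>t \<in> T. clamp l (term_val (tuple_code \<rho> r w) t),
                \<lambda>(d, t) \<in> D. term_val (tuple_code \<rho> r w) t mod d))"

lemma restrict_eq_iff: "restrict f A = restrict g A \<longleftrightarrow> (\<forall>x \<in> A. f x = g x)"
  by (metis restrict_apply' restrict_ext)

lemma word_key_eq_iff:
  assumes "w \<noteq> []"
  shows "word_key \<rho> r l T D w = word_key \<rho> r l T D w' \<longleftrightarrow> w' \<noteq> [] \<and>
    (\<forall>t \<in> T. clamp l (term_val (tuple_code \<rho> r w) t) = clamp l (term_val (tuple_code \<rho> r w') t)) \<and>
    (\<forall>(d, t) \<in> D. term_val (tuple_code \<rho> r w) t mod d = term_val (tuple_code \<rho> r w') t mod d)"
  using assms by (auto simp: word_key_def restrict_eq_iff)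

text \<open>Each entry of the new key depends only on its old value and \<open>b\<close>: by
  \<open>clamp_step\<close> for \<open>T\<close>, by congruence modulo \<open>d\<close> for
  \<open>D\<close>.\<close>

lemma word_key_snoc:
  assumes "\<rho> \<ge> 1" "l > 0" "b \<in> tuple_alphabet \<rho> r"
    and T: "\<And>t. t \<in> T \<Longrightarrow> term_vars t \<subseteq> {..<r} \<and> pos_norm t \<le> l \<and> neg_norm t \<le> l"
    and D: "\<And>d t. (d, t) \<in> D \<Longrightarrow> term_vars t \<subseteq> {..<r}"
    and eq: "word_key \<rho> r l T D w = word_key \<rho> r l T D w'"
  shows "word_key \<rho> r l T D (w @ [b]) = word_key \<rho> r l T D (w' @ [b])"
proof (cases "w = []")
  case True
  then show ?thesis using eq by (simp add: word_key_def split: if_splits)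
next
  case False
  note eqs = eq[unfolded word_key_eq_iff[OF False]]
  have "clamp l (term_val (tuple_code \<rho> r (w @ [b])) t) =
      clamp l (term_val (tuple_code \<rho> r (w' @ [b])) t)" if "t \<in> T" for t
  proof -
    have "0 \<le> b ! i \<and> b ! i \<le> \<rho> - 1" if "i \<in> term_vars t" for i
      using tuple_alphabet_nth[OF assms(3)] T[OF \<open>t \<in> T\<close>] that by blast
    then have bounds: "- ((\<rho> - 1) * neg_norm t) \<le> term_val b t"
      "term_val b t \<le> (\<rho> - 1) * pos_norm t"
      using term_val_bounds[of t b "\<rho> - 1"] by auto
    \<comment> \<open>Scaling by \<open>\<rho> - 1 \<ge> 0\<close> turns the norm bounds into the
      window that \<open>clamp_step\<close> needs.\<close>
    have "(\<rho> - 1) * neg_norm t \<le> (\<rho> - 1) * l" "(\<rho> - 1) * pos_norm t \<le> (\<rho> - 1) * l"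
      using T[OF that] assms(1) by (auto intro: mult_left_mono)
    with bounds have s: "- ((\<rho> - 1) * l) \<le> term_val b t" "term_val b t \<le> (\<rho> - 1) * l"
      by linarith+
    have "clamp l (term_val (tuple_code \<rho> r w) t) = clamp l (term_val (tuple_code \<rho> r w') t)"
      using eqs that by blast
    from clamp_step[OF assms(2,1) s this] show ?thesis
      using eqs T[OF that] False by (simp add: term_val_snoc)
  qed
  moreover have "term_val (tuple_code \<rho> r (w @ [b])) t mod d =
      term_val (tuple_code \<rho> r (w' @ [b])) t mod d" if "(d, t) \<in> D" for d t
  proof -
    have "term_val (tuple_code \<rho> r w) t mod d = term_val (tuple_code \<rho> r w') t mod d"
      using eqs that by blast
    from mod_add_cong[OF mod_mult_cong[OF refl[of "\<rho> mod d"] this] refl]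
    show ?thesis using eqs D[OF that] False by (simp add: term_val_snoc)
  qed
  ultimately show ?thesis by (auto simp: word_key_eq_iff)
qed

text \<open>Each atom is decided by a single entry of the key: a comparison by a truncated value, a
  divisibility by a residue, which \<open>c'\<close> merely shifts.\<close>

lemma word_key_formula_holds:
  assumes "atoms \<psi> \<subseteq>
      {Cmp t R c | t R c. t \<in> T \<and> - l < c \<and> c < l} \<union>
      {Divides d t c' | d t c'. (d, t) \<in> D}"
    and "word_key \<rho> r l T D w = word_key \<rho> r l T D w'" "w \<noteq> []"
  shows "formula_holds (tuple_code \<rho> r w) \<psi> \<longleftrightarrow> formula_holds (tuple_code \<rho> r w') \<psi>"
proof (rule formula_holds_cong)
  fix p
  assume "p \<in> atoms \<psi>"
  note eqs = assms(2)[unfolded word_key_eq_iff[OF assms(3)]]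
  from subsetD[OF assms(1) \<open>p \<in> atoms \<psi>\<close>] consider
    t R c where "p = Cmp t R c" "t \<in> T" "- l < c" "c < l" |
    d t c where "p = Divides d t c" "(d, t) \<in> D"
    by blast
  then show "atomic_holds (tuple_code \<rho> r w) p \<longleftrightarrow> atomic_holds (tuple_code \<rho> r w') p"
  proof cases
    case 1
    have "clamp l (term_val (tuple_code \<rho> r w) t) = clamp l (term_val (tuple_code \<rho> r w') t)"
      using eqs 1(2) by blast
    from clamp_comparison[OF 1(3,4) this] show ?thesis by (simp add: 1(1))
  next
    case 2
    have "term_val (tuple_code \<rho> r w) t mod d = term_val (tuple_code \<rho> r w') t mod d"
      using eqs 2(2) by blast
    from mod_dvd_cong[OF this] show ?thesis by (simp add: 2(1))
  qed
qed

section \<open>The number of keys\<close>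

lemma card_word_keys:
  assumes "finite T" "T \<noteq> {}" "finite D" "l > 0" "\<forall>(d, t) \<in> D. 1 \<le> d \<and> d < l'"
  shows "finite (range (word_key \<rho> r l T D))"
    and "int (card (word_key \<rho> r l T D ` W)) \<le> (2 + 2 * l) ^ card T * l' ^ card D"
proof -
  let ?P = "PiE T (\<lambda>_. {- l..l})"
  let ?Q = "PiE D (\<lambda>(d, t). {0..<d})"
  let ?K = "insert None (Some ` (?P \<times> ?Q))"
  have fin: "finite ?P" "finite ?Q"
    using assms(1,3) by (auto intro!: finite_PiE)
  \<comment> \<open>\<open>l > 0\<close> keeps truncated values in \<open>{- l..l}\<close>, and
    \<open>d \<ge> 1\<close> puts residues in \<open>{0..<d}\<close>.\<close>
  have sub: "range (word_key \<rho> r l T D) \<subseteq> ?K"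
    using assms(4,5) by (fastforce simp: word_key_def clamp_def)
  show "finite (range (word_key \<rho> r l T D))"
    using sub fin by (auto intro: finite_subset)
  have P: "int (card ?P) = (2 * l + 1) ^ card T"
    using assms(1,4) by (simp add: card_PiE)
  have "int (card ?Q) = (\<Prod>(d, t) \<in> D. d)"
    using assms(3,5) by (auto simp: card_PiE of_nat_prod case_prod_beta intro!: prod.cong)
  also have "\<dots> \<le> (\<Prod>p \<in> D. l')"
    using assms(5) by (intro prod_mono) auto
  finally have Q: "int (card ?Q) \<le> l' ^ card D" by simp
  \<comment> \<open>If \<open>D\<close> is empty, \<open>l'\<close> is unconstrained, but the power
    is then 1.\<close>
  have l': "l' ^ card D \<ge> 1"
  proof (cases "D = {}")
    case False
    then have "l' \<ge> 1" using assms(5) by fastforce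
    then show ?thesis by simp
  qed simp
  have "card (word_key \<rho> r l T D ` W) \<le> card ?K"
    using sub fin by (intro card_mono) auto
  also have "\<dots> = 1 + card ?P * card ?Q"
    using fin by (simp add: card_image card_cartesian_product)
  finally have "int (card (word_key \<rho> r l T D ` W)) \<le> 1 + int (card ?P * card ?Q)"
    by linarith
  \<comment> \<open>The 1 counting \<open>None\<close> is enlarged to \<open>l' ^ card D\<close>,
    which then becomes a common factor.\<close>
  also have "\<dots> \<le> l' ^ card D + int (card ?P) * l' ^ card D"
    unfolding of_nat_mult using l' Q by (intro add_mono mult_left_mono) auto
  also have "\<dots> = ((2 * l + 1) ^ card T + 1) * l' ^ card D"
    by (simp add: P algebra_simps)
  \<comment> \<open>The remaining 1 is absorbed by raising the base from \<open>2 * l + 1\<close> to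
    \<open>2 * l + 2\<close>.\<close>
  also have "\<dots> \<le> (2 * l + 1 + 1) ^ card T * l' ^ card D"
    using l' assms(1,2,4) by (intro mult_right_mono power_Suc_base_ge) (auto simp: card_gt_0_iff)
  finally show "int (card (word_key \<rho> r l T D ` W)) \<le> (2 + 2 * l) ^ card T * l' ^ card D"
    by (simp add: algebra_simps)
qed

section \<open>Existence and size of the minimal automaton\<close>

theorem theorem3p12:
  fixes \<rho> l l' :: int
    and r :: nat
    and T :: "lterm set"
    and D :: "(int \<times> lterm) set"
    and \<psi> :: "atomic bool_comb"
    and U :: "int list set"
  assumes "\<rho> \<ge> 2"
    and "finite T" and "T \<noteq> {}"
    and "\<forall>t \<in> T. homogeneous t \<and> term_vars t \<subseteq> {..<r}"
    and "finite D"
    and "\<forall>(d, t) \<in> D. d \<ge> 1 \<and> homogeneous t \<and> term_vars t \<subseteq> {..<r}"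
    and "l > Max (pos_norm ` T \<union> neg_norm ` T)"
    and "\<forall>(d, t) \<in> D. l' > d"
    and "atoms \<psi> \<subseteq>
      {Cmp t R c | t R c. t \<in> T \<and> - l < c \<and> c < l} \<union>
      {Divides d t c' | d t c'. (d, t) \<in> D}"
    and "U = {a. length a = r \<and> formula_holds a \<psi>}"
  shows "(\<exists>A :: (nat, int list) dwa. minimal_dwa A \<and> represents \<rho> r A U) \<and>
    (\<forall>A :: ('q, int list) dwa. minimal_dwa A \<and> represents \<rho> r A U \<longrightarrow>
      int (card (states A)) \<le> (2 + 2 * l) ^ card T * l' ^ card D)"
proof -
  have norms: "pos_norm t < l" "neg_norm t < l" if "t \<in> T" for t
    using assms(2,7) that Max_ge[of "pos_norm ` T \<union> neg_norm ` T"]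
    by (meson UnCI finite_UnI finite_imageI imageI le_less_trans)+
  have "neg_norm t \<ge> 0" for t
    by (induction t) (auto simp: neg_norm_def)
  \<comment> \<open>\<open>T\<close> has an element, and its nonnegative norm lies below
    \<open>l\<close>.\<close>
  with norms(2) assms(3) have "l > 0" by (metis ex_in_conv le_less_trans)
  have D: "\<forall>(d, t) \<in> D. 1 \<le> d \<and> d < l'"
    using assms(6,8) by auto
  let ?\<Sigma> = "tuple_alphabet \<rho> r"
  let ?L = "{w \<in> lists ?\<Sigma>. w \<noteq> [] \<and> tuple_code \<rho> r w \<in> U}"
  let ?f = "word_key \<rho> r l T D"
  note keys = card_word_keys[OF assms(2,3,5) \<open>l > 0\<close> D, of \<rho> r]
  obtain B :: "(nat, int list) dwa" where B: "is_dwa B" "alphabet B = ?\<Sigma>" "language B = ?L"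
    "card (states B) = card (?f ` lists ?\<Sigma>)"
  proof (rule right_invariant_dwa[of ?\<Sigma> ?f ?L])
    show "finite (?f ` lists ?\<Sigma>)"
      using keys(1) by (rule rev_finite_subset) auto
  next
    fix w w' b
    assume "b \<in> ?\<Sigma>" "?f w = ?f w'"
    then show "?f (w @ [b]) = ?f (w' @ [b])"
      using assms(1,4,6) \<open>l > 0\<close> norms by (intro word_key_snoc) (auto simp: less_imp_le)
  next
    fix w w'
    assume w: "w \<in> ?L" "w' \<in> lists ?\<Sigma>" "?f w = ?f w'"
    \<comment> \<open>\<open>w\<close> is nonempty, so the common key is not
      \<open>None\<close>.\<close>
    then have "w' \<noteq> []" by (auto simp: word_key_eq_iff)
    then show "w' \<in> ?L"
      using w word_key_formula_holds[OF assms(9) w(3)] by (simp add: assms(10))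
  qed (use finite_tuple_alphabet in auto)
  show ?thesis
  proof (intro conjI allI impI)
    show "\<exists>A :: (nat, int list) dwa. minimal_dwa A \<and> represents \<rho> r A U"
      using minimal_dwa_exists[OF B(1)] B(2,3) by (simp add: represents_def)
  next
    fix A :: "('q, int list) dwa"
    assume "minimal_dwa A \<and> represents \<rho> r A U"
    \<comment> \<open>\<open>B\<close> has the alphabet and language of \<open>A\<close> and states
      in \<open>nat\<close>, so it is an admissible competitor whatever the state type of
      \<open>A\<close>.\<close>
    then have "card (states A) \<le> card (states B)"
      using B(1-3) by (simp add: minimal_dwa_def represents_def)
    then show "int (card (states A)) \<le> (2 + 2 * l) ^ card T * l' ^ card D"
      using keys(2)[of "lists ?\<Sigma>"] B(4) by linarith
  qed
qed

end
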